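(* The Cartesian product of a locally compact Hadamard space and a Hilbert space is weakly proper.
   Context: A Hadamard space is a complete $\mathrm{CAT}(0)$ space. A Hilbert space is a Hadamard space with its norm metric. The Cartesian product of Hadamard spaces $(H_1,d_1)$ and $(H_2,d_2)$ is the Hadamard space $H_1\times H_2$ with the usual product metric $d((x_1,x_2),(y_1,y_2))=\sqrt{d_1(x_1,y_1)^2+d_2(x_2,y_2)^2}$. For a Hadamard space $(H,d)$ and $x\in H$, $\Gamma_x(H)$ is the set of all constant speed geodesics $\gamma:[0,1]\to H$ (i.e. $d(\gamma(s),\gamma(t))=|s-t|\,d(\gamma(0),\gamma(1))$ for all $s,t\in[0,1]$) with $\gamma(0)=x$. For a geodesic $\gamma$, $P_\gamma$ denotes the metric projection onto (the image of) $\gamma$. Elementary sets: for $x\in H$, $\gamma\in\Gamma_x(H)$, $\varepsilon>0$, $U_x(\varepsilon;\gamma):=\{y\in H: d(x,P_\gamma y)<\varepsilon\}$; also $U_x(\varepsilon;\gamma_1,\dots,\gamma_n):=\bigcap_{i=1}^n U_x(\varepsilon;\gamma_i)$. Weak topology $\tau_w$: a set $U\subset H$ is weakly open if for every $x\in U$ there exist $\varepsilon>0$ and finitely many $\gamma_1,\dots,\gamma_n\in\Gamma_x(H)$ with $U_x(\varepsilon;\gamma_1,\dots,\gamma_n)\subseteq U$. The weakly open sets (together with $\emptyset$) form the topology $\tau_w$ on $H$. $H$ is weakly proper if for every $x\in H$, every $\gamma\in\Gamma_x(H)$ and every $\varepsilon>0$ there exists $V\in\tau_w$ with $x\in V\subseteq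 U_x(\varepsilon;\gamma)$. *)

theory Defs
  imports "HOL-Analysis.Analysis"
begin

text \<open>Metric spaces are types of class \<open>metric_space\<close>. The library's distance on a product type
  is the usual product metric (\<open>dist_prod_def\<close>).\<close>

definition geodesic :: "(real \<Rightarrow> 'a::metric_space) \<Rightarrow> bool" where
  "geodesic \<gamma> \<longleftrightarrow>
     (\<forall>s\<in>{0..1}. \<forall>t\<in>{0..1}. dist (\<gamma> s) (\<gamma> t) = \<bar>s - t\<bar> * dist (\<gamma> 0) (\<gamma> 1))"

text \<open>Only the values on \<open>{0..1}\<close> matter: every notion below depends on \<open>\<gamma>\<close> through these
  values alone. Constant geodesics are allowed.\<close>

definition geodesics_from :: "'a::metric_space \<Rightarrow> (real \<Rightarrow> 'a) set" where
  "geodesics_from x = {\<gamma>. geodesic \<gamma> \<and> \<gamma> 0 = x}"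

text \<open>The CAT(0) inequality compares two points of a geodesic triangle with the corresponding
  points of a Euclidean triangle with the same side lengths. If both points lie on one side,
  their distance is that of the comparison points; otherwise they lie on two sides that share a
  vertex, and \<open>\<gamma>\<close>, \<open>\<eta>\<close> are these sides parametrized from that vertex. The third side exists
  because the space is geodesic, and enters through its length only.\<close>

definition cat0_space :: "'a::metric_space itself \<Rightarrow> bool" where
  "cat0_space _ \<longleftrightarrow>
     (\<forall>x y::'a. \<exists>\<gamma>. geodesic \<gamma> \<and> \<gamma> 0 = x \<and> \<gamma> 1 = y) \<and>
     (\<forall>(\<gamma>::real \<Rightarrow> 'a) \<eta> (p::real^2) q r.
        geodesic \<gamma> \<and> geodesic \<eta> \<and> \<gamma> 0 = \<eta> 0 \<and>
        dist p q = dist (\<gamma> 0) (\<gamma> 1) \<and>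
        dist p r = dist (\<eta> 0) (\<eta> 1) \<and>
        dist q r = dist (\<gamma> 1) (\<eta> 1) \<longrightarrow>
        (\<forall>s\<in>{0..1}. \<forall>t\<in>{0..1}.
           dist (\<gamma> s) (\<eta> t) \<le> dist ((1 - s) *\<^sub>R p + s *\<^sub>R q) ((1 - t) *\<^sub>R p + t *\<^sub>R r)))"

definition hadamard_space :: "'a::metric_space itself \<Rightarrow> bool" where
  "hadamard_space _ \<longleftrightarrow> complete (UNIV :: 'a set) \<and> cat0_space TYPE('a)"

text \<open>The library's \<open>closest_point\<close> is restricted to spaces of class
  \<open>{real_inner, heine_borel}\<close>. In a Hadamard space the nearest point on a geodesic exists and is
  unique.\<close>

definition metric_proj :: "'a::metric_space set \<Rightarrow> 'a \<Rightarrow> 'a" where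
  "metric_proj S y = (THE z. z \<in> S \<and> (\<forall>w\<in>S. dist y z \<le> dist y w))"

definition elementary_set :: "'a::metric_space \<Rightarrow> real \<Rightarrow> (real \<Rightarrow> 'a) \<Rightarrow> 'a set" where
  "elementary_set x \<epsilon> \<gamma> = {y. dist x (metric_proj (\<gamma> ` {0..1}) y) < \<epsilon>}"

definition weakly_open :: "'a::metric_space set \<Rightarrow> bool" where
  "weakly_open U \<longleftrightarrow>
     (\<forall>x\<in>U. \<exists>\<epsilon>>0. \<exists>G. finite G \<and> G \<noteq> {} \<and> G \<subseteq> geodesics_from x \<and>
        (\<Inter>\<gamma>\<in>G. elementary_set x \<epsilon> \<gamma>) \<subseteq> U)"

definition weak_topology :: "'a::metric_space topology" where
  "weak_topology = topology weakly_open"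

lemma istopology_weakly_open: "istopology (weakly_open :: 'a::metric_space set \<Rightarrow> bool)"
  unfolding istopology_def
proof (intro conjI allI impI)
  fix S T :: "'a set"
  assume S: "weakly_open S" and T: "weakly_open T"
  show "weakly_open (S \<inter> T)"
    unfolding weakly_open_def
  proof
    fix x assume x: "x \<in> S \<inter> T"
    obtain e G where e: "e > 0" "finite G" "G \<noteq> {}" "G \<subseteq> geodesics_from x"
      "(\<Inter>\<gamma>\<in>G. elementary_set x e \<gamma>) \<subseteq> S"
      using S x unfolding weakly_open_def by (meson IntD1)
    obtain d K where d: "d > 0" "finite K" "K \<noteq> {}" "K \<subseteq> geodesics_from x"
      "(\<Inter>\<gamma>\<in>K. elementary_set x d \<gamma>) \<subseteq> T"
      using T x unfolding weakly_open_def by (meson IntD2)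
    have "(\<Inter>\<gamma>\<in>G \<union> K. elementary_set x (min e d) \<gamma>) \<subseteq>
        (\<Inter>\<gamma>\<in>G. elementary_set x e \<gamma>) \<inter> (\<Inter>\<gamma>\<in>K. elementary_set x d \<gamma>)"
      by (auto simp: elementary_set_def)
    also have "\<dots> \<subseteq> S \<inter> T"
      using e(5) d(5) by (rule Int_mono)
    finally have "(\<Inter>\<gamma>\<in>G \<union> K. elementary_set x (min e d) \<gamma>) \<subseteq> S \<inter> T" .
    moreover have "min e d > 0" "finite (G \<union> K)" "G \<union> K \<noteq> {}" "G \<union> K \<subseteq> geodesics_from x"
      using e d by auto
    ultimately show "\<exists>\<epsilon>>0. \<exists>G. finite G \<and> G \<noteq> {} \<and> G \<subseteq> geodesics_from x \<and>
        (\<Inter>\<gamma>\<in>G. elementary_set x \<epsilon> \<gamma>) \<subseteq> S \<inter> T"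
      by metis
  qed
next
  fix \<K> :: "'a set set"
  assume *: "\<forall>K\<in>\<K>. weakly_open K"
  show "weakly_open (\<Union>\<K>)"
    unfolding weakly_open_def
  proof
    fix x assume "x \<in> \<Union>\<K>"
    then obtain K where K: "K \<in> \<K>" "x \<in> K" by auto
    then have "weakly_open K" using * by simp
    then obtain e G where e: "e > 0" "finite G" "G \<noteq> {}" "G \<subseteq> geodesics_from x"
      "(\<Inter>\<gamma>\<in>G. elementary_set x e \<gamma>) \<subseteq> K"
      using K(2) unfolding weakly_open_def by meson
    have "(\<Inter>\<gamma>\<in>G. elementary_set x e \<gamma>) \<subseteq> \<Union>\<K>"
      using e(5) Union_upper[OF K(1)] by (rule subset_trans)
    with e show "\<exists>\<epsilon>>0. \<exists>G. finite G \<and> G \<noteq> {} \<and> G \<subseteq> geodesics_from x \<and>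
        (\<Inter>\<gamma>\<in>G. elementary_set x \<epsilon> \<gamma>) \<subseteq> \<Union>\<K>"
      by metis
  qed
qed

lemma openin_weak_topology: "openin weak_topology U \<longleftrightarrow> weakly_open U"
  by (simp add: weak_topology_def istopology_weakly_open)

definition weakly_proper :: "'a::metric_space itself \<Rightarrow> bool" where
  "weakly_proper _ \<longleftrightarrow>
     (\<forall>x::'a. \<forall>\<gamma>\<in>geodesics_from x. \<forall>\<epsilon>>0.
        \<exists>V. openin weak_topology V \<and> x \<in> V \<and> V \<subseteq> elementary_set x \<epsilon> \<gamma>)"

end

theory Submission
  imports Defs
begin

text \<open>
  Everything rests on the inequality of Bruhat and Tits, which compares a point and a geodesic
  with Stewart's identity in the Euclidean plane (\<open>bruhat_tits\<close> below). It holds in CAT(0)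
  spaces by comparison, in inner product spaces with equality, and it passes to products because
  squared distances add up. Two consequences are used. First, a geodesic of the product is the
  pair of a geodesic and an affine segment (\<open>geodesic_prodE\<close>). Second, the projection \<open>p\<close> of \<open>y\<close>
  to a geodesic satisfies \<open>d(y,p)\<^sup>2 + d(p,w)\<^sup>2 \<le> d(y,w)\<^sup>2\<close> for all \<open>w\<close> on the geodesic
  (\<open>metric_proj_pythagoras\<close>).

  Two kinds of subsets of the product are weakly open. One is \<open>ball a r \<times> UNIV\<close>
  (\<open>weakly_open_ball_times_UNIV\<close>): by local compactness a small closed ball about a point has a
  finite net, and a point outside the ball projects far away from the centre on the geodesic to
  one of the net points, namely one close to where the geodesic to the outside
  point leaves the ball. The other is \<open>UNIV \<times> {c. c \<bullet> v < k}\<close>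
  (\<open>weakly_open_UNIV_times_halfspace\<close>), since
  projecting to a segment in direction \<open>v\<close> reads off the coordinate along \<open>v\<close>.

  Finally let \<open>\<gamma>\<close> be a geodesic from \<open>(a, b)\<close> whose second component is \<open>b + t v\<close>. If \<open>p = \<gamma> s\<close> is
  the projection of \<open>(y, c)\<close>, the inequality above with \<open>w = (a, b)\<close> gives
  \<open>d((a,b), p)\<^sup>2 \<le> d(y,a)\<^sup>2 + 2 s ((c - b) \<bullet> v)\<close>. So, for small positive \<open>\<delta>\<close> and \<open>\<kappa>\<close>, a
  given elementary set of \<open>\<gamma>\<close> at \<open>(a, b)\<close> contains the intersection of \<open>ball a \<delta> \<times> UNIV\<close> with a half-space \<open>UNIV \<times> {c. (c - b) \<bullet> v < \<kappa>}\<close>, which is a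
  weakly open set containing \<open>(a, b)\<close>.
\<close>

section \<open>The Bruhat--Tits inequality\<close>

lemma geodesicD:
  assumes "geodesic \<gamma>" "s \<in> {0..1}" "t \<in> {0..1}"
  shows "dist (\<gamma> s) (\<gamma> t) = \<bar>s - t\<bar> * dist (\<gamma> 0) (\<gamma> 1)"
  using assms unfolding geodesic_def by blast

definition bruhat_tits :: "'a::metric_space itself \<Rightarrow> bool" where
  "bruhat_tits _ \<longleftrightarrow> (\<forall>(\<gamma>::real \<Rightarrow> 'a) z. \<forall>s\<in>{0..1}. geodesic \<gamma> \<longrightarrow>
     (dist z (\<gamma> s))\<^sup>2 \<le> (1 - s) * (dist z (\<gamma> 0))\<^sup>2 + s * (dist z (\<gamma> 1))\<^sup>2
                         - s * (1 - s) * (dist (\<gamma> 0) (\<gamma> 1))\<^sup>2)"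

lemma bruhat_titsD:
  fixes \<gamma> :: "real \<Rightarrow> 'a::metric_space"
  assumes "bruhat_tits TYPE('a)" "geodesic \<gamma>" "s \<in> {0..1}"
  shows "(dist z (\<gamma> s))\<^sup>2 \<le> (1 - s) * (dist z (\<gamma> 0))\<^sup>2 + s * (dist z (\<gamma> 1))\<^sup>2
                             - s * (1 - s) * (dist (\<gamma> 0) (\<gamma> 1))\<^sup>2"
  using assms unfolding bruhat_tits_def by blast

lemma cat0_space_geodesicE:
  fixes x y :: "'a::metric_space"
  assumes "cat0_space TYPE('a)"
  obtains \<gamma> where "geodesic \<gamma>" "\<gamma> 0 = x" "\<gamma> 1 = y"
  using conjunct1[OF assms[unfolded cat0_space_def]] by blast

lemma cat0_space_comparison:
  fixes \<gamma> \<eta> :: "real \<Rightarrow> 'a::metric_space" and p q r :: "real^2"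
  assumes "cat0_space TYPE('a)" "geodesic \<gamma>" "geodesic \<eta>" "\<gamma> 0 = \<eta> 0"
    and "dist p q = dist (\<gamma> 0) (\<gamma> 1)" "dist p r = dist (\<eta> 0) (\<eta> 1)"
      "dist q r = dist (\<gamma> 1) (\<eta> 1)"
    and "s \<in> {0..1}" "t \<in> {0..1}"
  shows "dist (\<gamma> s) (\<eta> t) \<le> dist ((1 - s) *\<^sub>R p + s *\<^sub>R q) ((1 - t) *\<^sub>R p + t *\<^sub>R r)"
  using conjunct2[OF assms(1)[unfolded cat0_space_def], THEN spec[of _ \<gamma>], THEN spec[of _ \<eta>],
      THEN spec[of _ p], THEN spec[of _ q], THEN spec[of _ r]] assms(2-)
  by blast

lemma stewart_identity:
  fixes p q z :: "'b::real_inner"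
  shows "(dist z ((1 - s) *\<^sub>R p + s *\<^sub>R q))\<^sup>2 =
    (1 - s) * (dist z p)\<^sup>2 + s * (dist z q)\<^sup>2 - s * (1 - s) * (dist p q)\<^sup>2"
  unfolding dist_norm power2_norm_eq_inner
  by (simp add: inner_simps inner_commute algebra_simps power2_eq_square)

lemma comparison_triangle_exists:
  fixes a b c :: real
  assumes "a \<ge> 0" "b \<ge> 0" "c \<ge> 0" "a \<le> b + c" "b \<le> a + c" "c \<le> a + b"
  obtains p q r :: "real^2" where "dist p q = a" "dist p r = b" "dist q r = c"
proof (cases "a = 0")
  case True
  then have "b = c" using assms by simp
  show ?thesis
    by (rule that[of 0 0 "vector [b, 0]"])
       (use True \<open>b = c\<close> assms in \<open>simp_all add: dist_vec_def L2_set_def sum_2\<close>)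
next
  case False
  then have a: "a > 0" using assms by simp
  \<comment> \<open>The law of cosines determines the first coordinate of the third vertex.\<close>
  define x where "x = (a\<^sup>2 + b\<^sup>2 - c\<^sup>2) / (2 * a)"
  have x: "2 * a * x = a\<^sup>2 + b\<^sup>2 - c\<^sup>2" using a by (simp add: x_def)
  have "(a - b)\<^sup>2 \<le> c\<^sup>2" using assms by (intro abs_le_square_iff[THEN iffD1]) auto
  then have "2 * a * x \<le> 2 * a * b"
    unfolding x by (simp add: power2_eq_square algebra_simps)
  then have "x \<le> b" using a by simp
  moreover have "c\<^sup>2 \<le> (a + b)\<^sup>2" using assms by (intro power_mono) auto
  then have "2 * a * (- b) \<le> 2 * a * x"
    unfolding x by (simp add: power2_eq_square algebra_simps)
  then have "- b \<le> x" using a by (simp only: mult_le_cancel_left_pos[of "2 * a"])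
  ultimately have "x\<^sup>2 \<le> b\<^sup>2" by (intro abs_le_square_iff[THEN iffD1]) auto
  define y where "y = sqrt (b\<^sup>2 - x\<^sup>2)"
  have y: "y\<^sup>2 = b\<^sup>2 - x\<^sup>2" using \<open>x\<^sup>2 \<le> b\<^sup>2\<close> by (simp add: y_def)
  have "(a - x)\<^sup>2 + y\<^sup>2 = c\<^sup>2" unfolding y using x by (simp add: power2_eq_square algebra_simps)
  then show ?thesis
    by (intro that[of 0 "vector [a, 0]" "vector [x, y]"])
       (use a y assms in \<open>simp_all add: dist_vec_def L2_set_def sum_2 dist_real_def\<close>)
qed

text \<open>The comparison inequality for a point of a side and the opposite vertex, with the
  Euclidean distance evaluated by Stewart's identity.\<close>

lemma cat0_space_imp_bruhat_tits:
  assumes "cat0_space TYPE('a::metric_space)"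
  shows "bruhat_tits TYPE('a)"
  unfolding bruhat_tits_def
proof (intro allI ballI impI)
  fix \<gamma> :: "real \<Rightarrow> 'a" and z s
  assume s: "s \<in> {0..1::real}" and g: "geodesic \<gamma>"
  obtain \<eta> :: "real \<Rightarrow> 'a" where \<eta>: "geodesic \<eta>" "\<eta> 0 = \<gamma> 0" "\<eta> 1 = z"
    using cat0_space_geodesicE[OF assms] .
  obtain p q r :: "real^2" where pqr: "dist p q = dist (\<gamma> 0) (\<gamma> 1)" "dist p r = dist (\<gamma> 0) z"
    "dist q r = dist (\<gamma> 1) z"
  proof (rule comparison_triangle_exists[of "dist (\<gamma> 0) (\<gamma> 1)" "dist (\<gamma> 0) z" "dist (\<gamma> 1) z"])
    show "dist (\<gamma> 0) (\<gamma> 1) \<le> dist (\<gamma> 0) z + dist (\<gamma> 1) z" by (rule dist_triangle2)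
    show "dist (\<gamma> 0) z \<le> dist (\<gamma> 0) (\<gamma> 1) + dist (\<gamma> 1) z" by (rule dist_triangle)
    show "dist (\<gamma> 1) z \<le> dist (\<gamma> 0) (\<gamma> 1) + dist (\<gamma> 0) z" by (rule dist_triangle3)
  qed simp_all
  have "dist (\<gamma> s) (\<eta> 1) \<le> dist ((1 - s) *\<^sub>R p + s *\<^sub>R q) ((1 - 1) *\<^sub>R p + 1 *\<^sub>R r)"
    by (rule cat0_space_comparison[OF assms g \<eta>(1)]) (simp_all add: \<eta> pqr s[simplified])
  then have "dist z (\<gamma> s) \<le> dist r ((1 - s) *\<^sub>R p + s *\<^sub>R q)"
    using \<eta> by (simp add: dist_commute)
  then have "(dist z (\<gamma> s))\<^sup>2 \<le> (dist r ((1 - s) *\<^sub>R p + s *\<^sub>R q))\<^sup>2"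
    by (intro power_mono) auto
  then show "(dist z (\<gamma> s))\<^sup>2 \<le> (1 - s) * (dist z (\<gamma> 0))\<^sup>2 + s * (dist z (\<gamma> 1))\<^sup>2
      - s * (1 - s) * (dist (\<gamma> 0) (\<gamma> 1))\<^sup>2"
    unfolding stewart_identity using pqr by (simp add: dist_commute)
qed

section \<open>Geodesics in the product\<close>

lemma dist_prod_square:
  "(dist x y)\<^sup>2 = (dist (fst x) (fst y))\<^sup>2 + (dist (snd x) (snd y))\<^sup>2"
  by (simp add: dist_prod_def)

text \<open>The point \<open>m\<close> built from a geodesic and an affine segment between the two components of the
  end points satisfies the Bruhat--Tits inequality. Applied to \<open>z = \<gamma> s\<close>, whose distances to the
  end points are known, its right-hand side vanishes, so that \<open>\<gamma> s = m\<close>.\<close>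

lemma geodesic_prodE:
  fixes \<gamma> :: "real \<Rightarrow> 'a::metric_space \<times> 'b::real_inner"
  assumes "cat0_space TYPE('a)" and g: "geodesic \<gamma>"
  obtains \<alpha> where "geodesic \<alpha>" "\<alpha> 0 = fst (\<gamma> 0)" "\<alpha> 1 = fst (\<gamma> 1)"
    "\<And>s. s \<in> {0..1} \<Longrightarrow> \<gamma> s = (\<alpha> s, (1 - s) *\<^sub>R snd (\<gamma> 0) + s *\<^sub>R snd (\<gamma> 1))"
proof -
  obtain \<alpha> :: "real \<Rightarrow> 'a"
    where \<alpha>: "geodesic \<alpha>" "\<alpha> 0 = fst (\<gamma> 0)" "\<alpha> 1 = fst (\<gamma> 1)"
    using cat0_space_geodesicE[OF assms(1)] .
  have "\<gamma> s = (\<alpha> s, (1 - s) *\<^sub>R snd (\<gamma> 0) + s *\<^sub>R snd (\<gamma> 1))" if s: "s \<in> {0..1}" for s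
  proof -
    define m where "m = (\<alpha> s, (1 - s) *\<^sub>R snd (\<gamma> 0) + s *\<^sub>R snd (\<gamma> 1))"
    define D where "D = dist (\<gamma> 0) (\<gamma> 1)"
    have "dist (\<gamma> s) (\<gamma> u) = \<bar>s - u\<bar> * D" if "u \<in> {0..1}" for u
      unfolding D_def using g s that by (rule geodesicD)
    from this[of 0] this[of 1]
    have d: "dist (\<gamma> s) (\<gamma> 0) = s * D" "dist (\<gamma> s) (\<gamma> 1) = (1 - s) * D"
      using s by simp_all
    have "(dist (\<gamma> s) m)\<^sup>2 \<le> (1 - s) * (dist (\<gamma> s) (\<gamma> 0))\<^sup>2 + s * (dist (\<gamma> s) (\<gamma> 1))\<^sup>2
        - s * (1 - s) * (dist (\<gamma> 0) (\<gamma> 1))\<^sup>2"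
      using bruhat_titsD[OF cat0_space_imp_bruhat_tits[OF assms(1)] \<alpha>(1) s, of "fst (\<gamma> s)"]
        stewart_identity[of "snd (\<gamma> s)" s "snd (\<gamma> 0)" "snd (\<gamma> 1)"]
      unfolding dist_prod_square[of _ m] dist_prod_square[of _ "\<gamma> _"] \<alpha>(2,3)
      by (simp add: m_def algebra_simps)
    also have "\<dots> = 0" unfolding d by (simp add: D_def power2_eq_square algebra_simps)
    finally show ?thesis by (simp add: m_def)
  qed
  with \<alpha> show ?thesis by (rule that)
qed

lemma bruhat_tits_prod:
  assumes "cat0_space TYPE('a::metric_space)"
  shows "bruhat_tits TYPE('a \<times> 'b::real_inner)"
  unfolding bruhat_tits_def
proof (intro allI ballI impI)
  fix \<gamma> :: "real \<Rightarrow> 'a \<times> 'b" and z s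
  assume s: "s \<in> {0..1::real}" and g: "geodesic \<gamma>"
  obtain \<alpha> where \<alpha>: "geodesic \<alpha>" "\<alpha> 0 = fst (\<gamma> 0)" "\<alpha> 1 = fst (\<gamma> 1)"
    and eq: "\<And>s. s \<in> {0..1} \<Longrightarrow> \<gamma> s = (\<alpha> s, (1 - s) *\<^sub>R snd (\<gamma> 0) + s *\<^sub>R snd (\<gamma> 1))"
    using geodesic_prodE[OF assms g] by blast
  show "(dist z (\<gamma> s))\<^sup>2 \<le> (1 - s) * (dist z (\<gamma> 0))\<^sup>2 + s * (dist z (\<gamma> 1))\<^sup>2
      - s * (1 - s) * (dist (\<gamma> 0) (\<gamma> 1))\<^sup>2"
    using bruhat_titsD[OF cat0_space_imp_bruhat_tits[OF assms] \<alpha>(1) s, of "fst z"]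
      stewart_identity[of "snd z" s "snd (\<gamma> 0)" "snd (\<gamma> 1)"]
    unfolding dist_prod_square[of _ "\<gamma> _"] \<alpha>(2,3) by (simp add: eq[OF s] algebra_simps)
qed

lemma geodesic_Pair_const:
  assumes "geodesic \<alpha>"
  shows "geodesic (\<lambda>t. (\<alpha> t, b))"
  unfolding geodesic_def
proof (intro ballI)
  fix s t :: real
  assume "s \<in> {0..1}" "t \<in> {0..1}"
  from geodesicD[OF assms this]
  show "dist (\<alpha> s, b) (\<alpha> t, b) = \<bar>s - t\<bar> * dist (\<alpha> 0, b) (\<alpha> 1, b)"
    by (simp add: dist_Pair_Pair)
qed

lemma geodesic_Pair_segment:
  fixes b v :: "'b::real_inner"
  shows "geodesic (\<lambda>t. (a, b + t *\<^sub>R v))"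
  unfolding geodesic_def
proof (intro ballI)
  fix s t :: real
  have "dist (b + s *\<^sub>R v) (b + t *\<^sub>R v) = norm ((s - t) *\<^sub>R v)" for s t
    by (simp add: dist_norm scaleR_left_diff_distrib)
  from this[of s t] this[of 0 1]
  show "dist (a, b + s *\<^sub>R v) (a, b + t *\<^sub>R v) =
      \<bar>s - t\<bar> * dist (a, b + 0 *\<^sub>R v) (a, b + 1 *\<^sub>R v)"
    by (simp add: dist_Pair_Pair)
qed

section \<open>Projections to geodesics\<close>

lemma continuous_on_geodesic:
  assumes "geodesic \<gamma>"
  shows "continuous_on {0..1} \<gamma>"
proof (rule lipschitz_on_continuous_on[OF lipschitz_onI])
  fix s t :: real
  assume "s \<in> {0..1}" "t \<in> {0..1}"
  from geodesicD[OF assms this]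
  show "dist (\<gamma> s) (\<gamma> t) \<le> dist (\<gamma> 0) (\<gamma> 1) * dist s t"
    by (simp add: dist_real_def)
qed simp

lemma geodesic_reparametrize:
  assumes g: "geodesic \<gamma>" and st: "s \<in> {0..1}" "t \<in> {0..1}"
  shows "geodesic (\<lambda>u. \<gamma> (s + u * (t - s)))"
  unfolding geodesic_def
proof (intro ballI)
  fix u v :: real
  have convex: "s + u * (t - s) \<in> {0..1}" if "u \<in> {0..1}" for u
    using st that convexD_alt[of "{0..1::real}" s t u] by (simp add: algebra_simps)
  assume "u \<in> {0..1}" "v \<in> {0..1}"
  moreover have "s + u * (t - s) - (s + v * (t - s)) = (u - v) * (t - s)"
    by (simp add: algebra_simps)
  moreover have "dist (\<gamma> s) (\<gamma> t) = \<bar>t - s\<bar> * dist (\<gamma> 0) (\<gamma> 1)"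
    using geodesicD[OF g st] by (simp only: abs_minus_commute)
  ultimately show "dist (\<gamma> (s + u * (t - s))) (\<gamma> (s + v * (t - s))) =
      \<bar>u - v\<bar> * dist (\<gamma> (s + 0 * (t - s))) (\<gamma> (s + 1 * (t - s)))"
    using geodesicD[OF g convex convex, of u v] by (simp add: abs_mult)
qed

text \<open>Moving from the nearest point \<open>p\<close> towards \<open>w\<close> does not decrease the distance to \<open>y\<close>. For
  the point at parameter \<open>u\<close> the Bruhat--Tits inequality turns this into the claim
  with the factor \<open>1 - u\<close> in front of the second summand; then \<open>u\<close> tends to \<open>0\<close>.\<close>

lemma nearest_point_pythagoras:
  fixes \<gamma> :: "real \<Rightarrow> 'a::metric_space"
  assumes "bruhat_tits TYPE('a)" and g: "geodesic \<gamma>"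
    and p: "p \<in> \<gamma> ` {0..1}" "\<And>w. w \<in> \<gamma> ` {0..1} \<Longrightarrow> dist y p \<le> dist y w"
    and w: "w \<in> \<gamma> ` {0..1}"
  shows "(dist y p)\<^sup>2 + (dist p w)\<^sup>2 \<le> (dist y w)\<^sup>2"
proof -
  obtain s t where st: "s \<in> {0..1}" "t \<in> {0..1}" "p = \<gamma> s" "w = \<gamma> t" using p w by auto
  have *: "(dist y p)\<^sup>2 + (1 - u) * (dist p w)\<^sup>2 \<le> (dist y w)\<^sup>2" if u: "0 < u" "u < 1" for u
  proof -
    have "s + u * (t - s) \<in> {0..1}"
      using st u convexD_alt[of "{0..1::real}" s t u] by (simp add: algebra_simps)
    then have "(dist y p)\<^sup>2 \<le> (dist y (\<gamma> (s + u * (t - s))))\<^sup>2"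
      using p by (intro power_mono) auto
    also have "\<dots> \<le> (1 - u) * (dist y p)\<^sup>2 + u * (dist y w)\<^sup>2 - u * (1 - u) * (dist p w)\<^sup>2"
      using bruhat_titsD[OF assms(1) geodesic_reparametrize[OF g st(1,2)], of u y] u st by simp
    finally have "u * ((dist y p)\<^sup>2 + (1 - u) * (dist p w)\<^sup>2) \<le> u * (dist y w)\<^sup>2"
      by (simp add: algebra_simps)
    then show ?thesis using u by simp
  qed
  have "((\<lambda>u. (dist y p)\<^sup>2 + (1 - u) * (dist p w)\<^sup>2) \<longlongrightarrow> (dist y p)\<^sup>2 + (1 - 0) * (dist p w)\<^sup>2)
      (at_right 0)"
    by (intro tendsto_intros)
  moreover have "\<forall>\<^sub>F u in at_right 0. (dist y p)\<^sup>2 + (1 - u) * (dist p w)\<^sup>2 \<le> (dist y w)\<^sup>2"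
    unfolding eventually_at_right_field using * by (intro exI[of _ 1]) auto
  ultimately have "(dist y p)\<^sup>2 + (1 - 0) * (dist p w)\<^sup>2 \<le> (dist y w)\<^sup>2"
    by (intro tendsto_upperbound[where F = "at_right (0::real)"]) auto
  then show ?thesis by simp
qed

text \<open>A nearest point exists by compactness of the geodesic. The inequality for a nearest point
  also shows that there is no second one, so that \<open>metric_proj\<close> denotes it.\<close>

lemma metric_proj_pythagoras:
  fixes \<gamma> :: "real \<Rightarrow> 'a::metric_space"
  assumes "bruhat_tits TYPE('a)" and g: "geodesic \<gamma>"
  shows metric_proj_mem: "metric_proj (\<gamma> ` {0..1}) y \<in> \<gamma> ` {0..1}"
    and "\<And>w. w \<in> \<gamma> ` {0..1} \<Longrightarrow> (dist y (metric_proj (\<gamma> ` {0..1}) y))\<^sup>2 +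
           (dist (metric_proj (\<gamma> ` {0..1}) y) w)\<^sup>2 \<le> (dist y w)\<^sup>2"
proof -
  let ?S = "\<gamma> ` {0..1}"
  have "compact ?S"
    using continuous_on_geodesic[OF g] compact_continuous_image by blast
  then obtain p where p: "p \<in> ?S" "\<forall>w\<in>?S. dist y p \<le> dist y w"
    using continuous_attains_inf[of ?S "dist y"]
      continuous_on_dist[OF continuous_on_const continuous_on_id]
    by auto
  have py: "(dist y p)\<^sup>2 + (dist p w)\<^sup>2 \<le> (dist y w)\<^sup>2" if "w \<in> ?S" for w
    using nearest_point_pythagoras[OF assms] p that by blast
  have "metric_proj ?S y = p"
    unfolding metric_proj_def
  proof (rule the_equality)
    fix z assume z: "z \<in> ?S \<and> (\<forall>w\<in>?S. dist y z \<le> dist y w)"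
    then have "(dist y z)\<^sup>2 \<le> (dist y p)\<^sup>2" using p by (intro power_mono) auto
    moreover have "(dist y p)\<^sup>2 + (dist p z)\<^sup>2 \<le> (dist y z)\<^sup>2" using py z by blast
    ultimately have "(dist p z)\<^sup>2 \<le> 0" by linarith
    then show "z = p" by simp
  qed (use p in auto)
  with p py show "metric_proj ?S y \<in> ?S"
    "\<And>w. w \<in> ?S \<Longrightarrow> (dist y (metric_proj ?S y))\<^sup>2 + (dist (metric_proj ?S y) w)\<^sup>2 \<le> (dist y w)\<^sup>2"
    by auto
qed

section \<open>Two kinds of weakly open sets\<close>

text \<open>Let \<open>d(z, a) \<ge> r\<close>. The geodesic from \<open>a\<close> to \<open>z\<close> has a point at distance \<open>r\<close>
  from \<open>a\<close>, and some net point \<open>w\<close> is so close to it that \<open>d(z, w) < d(z, a) - 3 r/4\<close>. If the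
  projection \<open>p\<close> of \<open>z\<close> to the geodesic from \<open>a\<close> to \<open>w\<close> had distance less than \<open>r/4\<close> from \<open>a\<close>, then
  \<open>d(z, p) > d(z, a) - r/4\<close>, and \<open>w\<close> would be closer to \<open>z\<close> than \<open>p\<close>.
  In the product the geodesics to the net points have a constant second component, which
  therefore contributes equally to the two distances.\<close>

lemma weakly_nhd_ball_times_UNIV:
  fixes a :: "'a::metric_space" and b :: "'b::real_inner"
  assumes cat0: "cat0_space TYPE('a)" and r: "r > 0" and "compact (cball a r)"
  obtains G where "finite G" "G \<noteq> {}" "G \<subseteq> geodesics_from (a, b)"
    "(\<Inter>\<gamma>\<in>G. elementary_set (a, b) (r / 4) \<gamma>) \<subseteq> ball a r \<times> UNIV"
proof -
  obtain N where N: "finite N" "cball a r \<subseteq> (\<Union>w\<in>N. ball w (r / 4))"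
    using assms(3) r unfolding compact_eq_totally_bounded
    by (meson zero_less_divide_iff zero_less_numeral)
  have "\<exists>\<alpha>. geodesic \<alpha> \<and> \<alpha> 0 = a \<and> \<alpha> 1 = w" for w
    using cat0_space_geodesicE[OF cat0] by metis
  then obtain \<alpha> where \<alpha>: "\<And>w. geodesic (\<alpha> w)" "\<And>w. \<alpha> w 0 = a" "\<And>w. \<alpha> w 1 = w" by metis
  define \<gamma> where "\<gamma> w t = (\<alpha> w t, b)" for w t
  have \<gamma>: "geodesic (\<gamma> w)" for w
    unfolding \<gamma>_def[abs_def] using \<alpha>(1) by (rule geodesic_Pair_const)
  show ?thesis
  proof
    show "finite (\<gamma> ` N)" using N by simp
    show "\<gamma> ` N \<noteq> {}" using N(2) r by auto
    show "\<gamma> ` N \<subseteq> geodesics_from (a, b)"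
      using \<gamma> by (auto simp: geodesics_from_def \<gamma>_def \<alpha>)
    show "(\<Inter>\<gamma>\<in>\<gamma> ` N. elementary_set (a, b) (r / 4) \<gamma>) \<subseteq> ball a r \<times> UNIV"
    proof (rule subrelI, rule ccontr)
      fix z :: 'a and c :: 'b
      assume z: "(z, c) \<in> (\<Inter>\<gamma>\<in>\<gamma> ` N. elementary_set (a, b) (r / 4) \<gamma>)"
        and "(z, c) \<notin> ball a r \<times> UNIV"
      then have D: "dist a z \<ge> r" by simp
      define y where "y = \<alpha> z (r / dist a z)"
      have s: "r / dist a z \<in> {0..1}" using D r by (auto simp: divide_le_eq_1)
      have "dist (\<alpha> z u) y = \<bar>u - r / dist a z\<bar> * dist (\<alpha> z 0) (\<alpha> z 1)" if "u \<in> {0..1}" for u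
        unfolding y_def using \<alpha>(1) that s by (rule geodesicD)
      from this[of 0] this[of 1]
      moreover have "a \<noteq> z" using D r by auto
      ultimately have y: "dist a y = r" "dist y z = dist a z - r"
        using s r D by (simp_all add: \<alpha> dist_commute left_diff_distrib)
      then obtain w where w: "w \<in> N" "dist w y < r / 4" using N(2) by auto
      obtain p where p: "metric_proj (\<gamma> w ` {0..1}) (z, c) = (p, b)"
        using metric_proj_mem[OF bruhat_tits_prod[OF cat0] \<gamma>, of w "(z, c)"]
        by (auto simp: \<gamma>_def)
      have "(w, b) \<in> \<gamma> w ` {0..1}"
        by (rule image_eqI[of _ _ 1]) (simp_all add: \<gamma>_def \<alpha>)
      then have "(dist (z, c) (p, b))\<^sup>2 + (dist (p, b) (w, b))\<^sup>2 \<le> (dist (z, c) (w, b))\<^sup>2"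
        using metric_proj_pythagoras(2)[OF bruhat_tits_prod[OF cat0] \<gamma>, of "(w, b)" w "(z, c)"]
        unfolding p by blast
      then have "(dist z p)\<^sup>2 \<le> (dist z w)\<^sup>2"
        using zero_le_power2[of "dist p w"] zero_le_power2[of "dist b b"]
        unfolding dist_prod_square fst_conv snd_conv by linarith
      then have "dist z p \<le> dist z w" by (rule power2_le_imp_le) simp
      moreover have "dist a p < r / 4"
      proof -
        have "dist (a, b) (p, b) < r / 4" using z w(1) p by (auto simp: elementary_set_def)
        then show ?thesis by (simp add: dist_prod_def)
      qed
      moreover have "dist z w \<le> dist y z + dist w y" "dist a z \<le> dist a p + dist z p"
        using dist_triangle[of z w y] dist_triangle[of a z p] by (simp_all add: dist_commute)
      ultimately show False using y w(2) r by linarith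
    qed
  qed
qed

lemma locally_compact_cball:
  fixes x :: "'a::metric_space"
  assumes "locally_compact_space (euclidean :: 'a topology)" and "open U" "x \<in> U"
  obtains r where "r > 0" "cball x r \<subseteq> U" "compact (cball x r)"
proof -
  obtain W K where K: "open W" "compact K" "x \<in> W" "W \<subseteq> K"
    using assms(1) unfolding locally_compact_space_def by simp blast
  then obtain r where r: "r > 0" "cball x r \<subseteq> U \<inter> W"
    using assms open_contains_cball[of "U \<inter> W"] by (meson IntI open_Int)
  then have "compact (K \<inter> cball x r)" using K by (intro compact_Int_closed) auto
  moreover have "K \<inter> cball x r = cball x r" using r K by auto
  ultimately show ?thesis using that r by simp
qed

lemma weakly_open_ball_times_UNIV:
  fixes a :: "'a::metric_space"
  assumes "cat0_space TYPE('a)" and "locally_compact_space (euclidean :: 'a topology)"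
  shows "weakly_open (ball a \<delta> \<times> (UNIV :: 'b::real_inner set))"
  unfolding weakly_open_def
proof (rule ballI, clarify)
  fix x :: 'a and b :: 'b
  assume x: "x \<in> ball a \<delta>"
  obtain r where r: "r > 0" "cball x r \<subseteq> ball a \<delta>" "compact (cball x r)"
    using locally_compact_cball[OF assms(2) open_ball x] .
  obtain G where G: "finite G" "G \<noteq> {}" "G \<subseteq> geodesics_from (x, b)"
    "(\<Inter>\<gamma>\<in>G. elementary_set (x, b) (r / 4) \<gamma>) \<subseteq> ball x r \<times> UNIV"
    using weakly_nhd_ball_times_UNIV[OF assms(1) r(1,3)] .
  have "ball x r \<times> UNIV \<subseteq> ball a \<delta> \<times> (UNIV :: 'b set)"
    using r(2) ball_subset_cball by blast
  with G have "(\<Inter>\<gamma>\<in>G. elementary_set (x, b) (r / 4) \<gamma>) \<subseteq> ball a \<delta> \<times> UNIV"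
    by (rule_tac subset_trans)
  with G r(1) show "\<exists>\<epsilon>>0. \<exists>G. finite G \<and> G \<noteq> {} \<and> G \<subseteq> geodesics_from (x, b) \<and>
      (\<Inter>\<gamma>\<in>G. elementary_set (x, b) \<epsilon> \<gamma>) \<subseteq> ball a \<delta> \<times> UNIV"
    by (intro exI[of _ "r / 4"] conjI exI[of _ G]) auto
qed

text \<open>Let \<open>(x, b + s v)\<close> be the projection of \<open>(y, c)\<close> to the segment from \<open>(x, b)\<close> in direction
  \<open>(0, v)\<close>. If \<open>s < 1\<close>, comparison with the far end of the segment shows that
  \<open>(c - b) \<bullet> v \<le> s |v|\<^sup>2\<close>, so a small \<open>s\<close> keeps \<open>c\<close> in the half-space of \<open>b\<close>.\<close>

lemma weakly_open_UNIV_times_halfspace: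
  fixes v :: "'b::real_inner"
  assumes cat0: "cat0_space TYPE('a::metric_space)"
  shows "weakly_open ((UNIV :: 'a set) \<times> {c. c \<bullet> v < k})"
  unfolding weakly_open_def
proof (rule ballI, clarify)
  fix x :: 'a and b :: 'b
  assume b: "b \<bullet> v < k"
  define \<gamma> where "\<gamma> t = (x, b + t *\<^sub>R v)" for t :: real
  have g: "geodesic \<gamma>" unfolding \<gamma>_def[abs_def] by (rule geodesic_Pair_segment)
  \<comment> \<open>The first bound excludes \<open>s = 1\<close>, the second one keeps \<open>s |v|\<^sup>2\<close> below \<open>k - b \<bullet> v\<close>. For \<open>v = 0\<close>
    the half-space is the whole space.\<close>
  define \<epsilon> where "\<epsilon> = (if v = 0 then 1 else min (norm v) ((k - b \<bullet> v) / norm v))"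
  have "\<epsilon> > 0" using b by (simp add: \<epsilon>_def)
  moreover have "elementary_set (x, b) \<epsilon> \<gamma> \<subseteq> UNIV \<times> {c. c \<bullet> v < k}"
  proof (rule subrelI)
    fix y :: 'a and c :: 'b
    assume "(y, c) \<in> elementary_set (x, b) \<epsilon> \<gamma>"
    then have e: "dist (x, b) (metric_proj (\<gamma> ` {0..1}) (y, c)) < \<epsilon>"
      by (simp add: elementary_set_def)
    have "c \<bullet> v < k"
    proof (cases "v = 0")
      case False
      obtain s where s: "s \<in> {0..1}" "metric_proj (\<gamma> ` {0..1}) (y, c) = \<gamma> s"
        using metric_proj_mem[OF bruhat_tits_prod[OF cat0] g, of "(y, c)"] by auto
      have sv: "s * norm v < \<epsilon>"
        using e s by (simp add: s \<gamma>_def dist_prod_def dist_norm)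
      then have "s * norm v < 1 * norm v" using False by (simp add: \<epsilon>_def)
      then have "s < 1" using False by simp
      have "s * norm v < (k - b \<bullet> v) / norm v" using sv False by (simp add: \<epsilon>_def)
      then have "s * (norm v)\<^sup>2 < k - b \<bullet> v"
        using False by (simp add: less_divide_eq power2_eq_square mult.assoc)
      have "(dist (y, c) (\<gamma> s))\<^sup>2 + (dist (\<gamma> s) (\<gamma> 1))\<^sup>2 \<le> (dist (y, c) (\<gamma> 1))\<^sup>2"
        using metric_proj_pythagoras(2)[OF bruhat_tits_prod[OF cat0] g, of "\<gamma> 1" "(y, c)"]
        unfolding s by auto
      then have "(1 - s) * ((c - b) \<bullet> v - s * (norm v)\<^sup>2) \<le> 0"
        unfolding dist_prod_square dist_norm power2_norm_eq_inner
        by (simp add: \<gamma>_def inner_simps inner_commute algebra_simps power2_eq_square)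
      then have "(c - b) \<bullet> v \<le> s * (norm v)\<^sup>2"
        using \<open>s < 1\<close> by (simp add: mult_le_0_iff)
      with \<open>s * (norm v)\<^sup>2 < k - b \<bullet> v\<close> show ?thesis by (simp add: inner_diff_left)
    qed (use b in simp)
    then show "(y, c) \<in> UNIV \<times> {c. c \<bullet> v < k}" by simp
  qed
  moreover have "\<gamma> \<in> geodesics_from (x, b)" using g by (simp add: geodesics_from_def \<gamma>_def)
  ultimately show "\<exists>\<epsilon>>0. \<exists>G. finite G \<and> G \<noteq> {} \<and> G \<subseteq> geodesics_from (x, b) \<and>
      (\<Inter>\<gamma>\<in>G. elementary_set (x, b) \<epsilon> \<gamma>) \<subseteq> UNIV \<times> {c. c \<bullet> v < k}"
    by (intro exI[of _ \<epsilon>] conjI exI[of _ "{\<gamma>}"]) auto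
qed

section \<open>Weak properness of the product\<close>

theorem corollary12:
  assumes "hadamard_space TYPE('a::metric_space)"
    and "locally_compact_space (euclidean :: 'a topology)"
  shows "weakly_proper TYPE('a \<times> 'b::{real_inner, complete_space})"
  unfolding weakly_proper_def
proof (intro allI ballI impI)
  fix x :: "'a \<times> 'b" and \<gamma> and \<epsilon> :: real
  assume "\<gamma> \<in> geodesics_from x" and \<epsilon>: "\<epsilon> > 0"
  then have g: "geodesic \<gamma>" and x: "\<gamma> 0 = x" by (auto simp: geodesics_from_def)
  have cat0: "cat0_space TYPE('a)" using assms(1) by (simp add: hadamard_space_def)
  obtain a b where ab: "x = (a, b)" by fastforce
  define v where "v = snd (\<gamma> 1) - b"
  \<comment> \<open>The radius and the width of the half-space are chosen such that
    \<open>(\<epsilon> / 2)\<^sup>2 + 2 * (\<epsilon>\<^sup>2 / 4) < \<epsilon>\<^sup>2\<close>.\<close>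
  define V where "V = (ball a (\<epsilon> / 2) \<times> UNIV) \<inter> (UNIV \<times> {c. c \<bullet> v < b \<bullet> v + \<epsilon>\<^sup>2 / 4})"
  have "openin weak_topology V"
    unfolding V_def
    by (intro openin_Int)
       (simp_all only: openin_weak_topology weakly_open_ball_times_UNIV[OF cat0 assms(2)]
          weakly_open_UNIV_times_halfspace[OF cat0])
  moreover have "x \<in> V" using \<epsilon> by (simp add: V_def ab)
  moreover have "V \<subseteq> elementary_set x \<epsilon> \<gamma>"
  proof (rule subrelI)
    fix y :: 'a and c :: 'b
    assume "(y, c) \<in> V"
    then have y: "dist a y < \<epsilon> / 2" and c: "(c - b) \<bullet> v < \<epsilon>\<^sup>2 / 4"
      by (auto simp: V_def inner_diff_left)
    obtain s where s: "s \<in> {0..1}" "metric_proj (\<gamma> ` {0..1}) (y, c) = \<gamma> s"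
      using metric_proj_mem[OF bruhat_tits_prod[OF cat0] g, of "(y, c)"] by auto
    have "snd (\<gamma> s) = (1 - s) *\<^sub>R snd (\<gamma> 0) + s *\<^sub>R snd (\<gamma> 1)"
      using geodesic_prodE[OF cat0 g] s(1) by (metis snd_conv)
    then have snd: "snd (\<gamma> s) = b + s *\<^sub>R v"
      by (simp add: x ab v_def algebra_simps)
    have "(dist (y, c) (\<gamma> s))\<^sup>2 + (dist (\<gamma> s) x)\<^sup>2 \<le> (dist (y, c) x)\<^sup>2"
      using metric_proj_pythagoras(2)[OF bruhat_tits_prod[OF cat0] g, of x "(y, c)"] x
      unfolding s by auto
    then have "(dist y (fst (\<gamma> s)))\<^sup>2 + (norm (c - b - s *\<^sub>R v))\<^sup>2 + (dist (\<gamma> s) x)\<^sup>2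
        \<le> (dist a y)\<^sup>2 + (norm (c - b))\<^sup>2"
      unfolding dist_prod_square[of "(y, c)"] dist_commute[of a y]
      by (simp add: ab snd dist_norm diff_diff_eq)
    then have "(dist (\<gamma> s) x)\<^sup>2 \<le> (dist a y)\<^sup>2 + (norm (c - b))\<^sup>2 - (norm (c - b - s *\<^sub>R v))\<^sup>2"
      using zero_le_power2[of "dist y (fst (\<gamma> s))"] by linarith
    also have "\<dots> = (dist a y)\<^sup>2 + 2 * s * ((c - b) \<bullet> v) - s\<^sup>2 * (norm v)\<^sup>2"
      unfolding power2_norm_eq_inner
      by (simp add: inner_simps inner_commute algebra_simps power2_eq_square)
    also have "\<dots> \<le> (\<epsilon> / 2)\<^sup>2 + 2 * (\<epsilon>\<^sup>2 / 4)"
    proof -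
      have "s * ((c - b) \<bullet> v) \<le> s * (\<epsilon>\<^sup>2 / 4)" using s c by (intro mult_left_mono) auto
      also have "\<dots> \<le> 1 * (\<epsilon>\<^sup>2 / 4)" using s by (intro mult_right_mono) auto
      finally have "2 * s * ((c - b) \<bullet> v) \<le> 2 * (\<epsilon>\<^sup>2 / 4)" by simp
      moreover have "(dist a y)\<^sup>2 \<le> (\<epsilon> / 2)\<^sup>2" using y by (intro power_mono) auto
      moreover have "0 \<le> s\<^sup>2 * (norm v)\<^sup>2" by simp
      ultimately show ?thesis by linarith
    qed
    also have "\<dots> < \<epsilon>\<^sup>2" using \<epsilon> by (simp add: power2_eq_square field_simps)
    finally have "dist (\<gamma> s) x < \<epsilon>" using \<epsilon> by (intro power2_less_imp_less[of _ \<epsilon>]) auto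
    then show "(y, c) \<in> elementary_set x \<epsilon> \<gamma>"
      by (simp add: elementary_set_def s dist_commute)
  qed
  ultimately show "\<exists>V. openin weak_topology V \<and> x \<in> V \<and> V \<subseteq> elementary_set x \<epsilon> \<gamma>" by blast
qed

end
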